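(* Assume stochastic linearity, the deviation condition and convexity as formulated in the context. Fix $\mathtt{x}>0$. Let $D$ be a symmetric positive definite $p\times p$ matrix with $D^2\le\varkappa^2\mathbb{F}$ for some $\varkappa>0$, and set $$B=\mathbb{F}^{-1/2}V^2\mathbb{F}^{-1/2},\qquad r_B=z(B,\mathtt{x}),\qquad \mathcal{U}=\{u\in\mathbb{R}^p:\|\mathbb{F}^{1/2}u\|\le \tfrac43 r_B\},$$ $$\delta_3'(\upsilon^*,u)=\langle\nabla f(\upsilon^*+u),u\rangle-\langle\nabla f(\upsilon^* ),u\rangle-\langle\nabla^2 f(\upsilon^* ),u^{\otimes2}\rangle,\qquad \omega'=\sup_{u\in\mathcal{U}}\frac{|\delta_3'(\upsilon^*,u)|}{\|Du\|^2}.$$ Let $\varkappa^2\omega'<1/4$. Then on the random set $\Omega(\mathtt{x})=\{\|\mathbb{F}^{-1/2}\nabla\zeta\|\le r_B\}$, which satisfies $\mathbb{P}(\Omega(\mathtt{x}))\ge1-3e^{-\mathtt{x}}$, it holds $$\|\mathbb{F}^{1/2}(\tilde\upsilon-\upsilon^* )\|\le\frac43 r_B,\qquad \|D(\tilde\upsilon-\upsilon^* )\|\le\frac{4\varkappa}{3}r_B .$$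
   Context: Let $L(\upsilon)$, $\upsilon\in\Upsilon\subseteq\mathbb{R}^p$ ($p<\infty$), be a real random function (e.g. a negative log-likelihood). Set $f(\upsilon)=\mathbb{E}L(\upsilon)$, $\tilde\upsilon=\arg\min_{\upsilon}L(\upsilon)$, $\upsilon^*=\arg\min_\upsilon \mathbb{E}L(\upsilon)$, $\mathbb{F}=\nabla^2 f(\upsilon^* )$, assumed positive definite. Norms are Euclidean for vectors and operator norms for matrices; inequalities between symmetric matrices are in the positive semidefinite order. Points $\upsilon^*+u$ at which derivatives are evaluated are understood to lie in $\Upsilon$. Stochastic linearity: $\zeta(\upsilon)=L(\upsilon)-\mathbb{E}L(\upsilon)$ is linear in $\upsilon$; its gradient, not depending on $\upsilon$, is the random vector $\nabla\zeta\in\mathbb{R}^p$. Deviation condition: there is a symmetric positive definite matrix $V^2\ge\mathrm{Var}(\nabla\zeta)$ such that for all symmetric positive definite $B\in\mathbb{R}^{p\times p}$ and $\mathtt{x}>0$ $$\mathbb{P}(\|B^{1/2}V^{-1}\nabla\zeta\|\ge z(B,\mathtt{x}))\le3e^{-\mathtt{x}},\qquad z^2(B,\mathtt{x})=\mathrm{tr}B+2\sqrt{\mathtt{x}\,\mathrm{tr}B^2}+2\mathtt{x}\|B\|.$$ Convexity: $\Upsilon$ is open and convex and $f=\mathbb{E}L$ is convex on $\Upsilon$. *)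

theory Defs
  imports "HOL-Probability.Probability"
begin

definition psd_matrix :: "real^'p^'p \<Rightarrow> bool" where
  "psd_matrix A \<longleftrightarrow> transpose A = A \<and> (\<forall>x. 0 \<le> inner x (A *v x))"

definition pd_matrix :: "real^'p^'p \<Rightarrow> bool" where
  "pd_matrix A \<longleftrightarrow> transpose A = A \<and> (\<forall>x. x \<noteq> 0 \<longrightarrow> 0 < inner x (A *v x))"

definition loewner_le :: "real^'p^'p \<Rightarrow> real^'p^'p \<Rightarrow> bool"  (infix \<open>\<preceq>\<^sub>L\<close> 50) where
  "A \<preceq>\<^sub>L B \<longleftrightarrow> psd_matrix (B - A)"

text \<open>The principal square root, meaningful for positive semidefinite matrices only.\<close>

definition mat_sqrt :: "real^'p^'p \<Rightarrow> real^'p^'p" where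
  "mat_sqrt A = (THE S. psd_matrix S \<and> S ** S = A)"

definition mat_inv_sqrt :: "real^'p^'p \<Rightarrow> real^'p^'p" where
  "mat_inv_sqrt A = matrix_inv (mat_sqrt A)"

definition op_norm :: "real^'p^'p \<Rightarrow> real" where
  "op_norm A = onorm (\<lambda>x. A *v x)"

text \<open>Gradient and Hessian are total functions; they are meaningful at a point where the
  function, respectively its gradient, is Frechet differentiable.\<close>

definition grad :: "(real^'p \<Rightarrow> real) \<Rightarrow> real^'p \<Rightarrow> real^'p" where
  "grad f x = (THE D. GDERIV f x :> D)"

definition hessian :: "(real^'p \<Rightarrow> real) \<Rightarrow> real^'p \<Rightarrow> real^'p^'p" where
  "hessian f x = matrix (frechet_derivative (grad f) (at x))"

definition variance_matrix :: "'a measure \<Rightarrow> ('a \<Rightarrow> real^'p) \<Rightarrow> real^'p^'p" where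
  "variance_matrix M X =
     (\<chi> i j. \<integral>\<omega>. (X \<omega> $ i - (\<integral>\<omega>'. X \<omega>' $ i \<partial>M)) * (X \<omega> $ j - (\<integral>\<omega>'. X \<omega>' $ j \<partial>M)) \<partial>M)"

definition mean_fun :: "'a measure \<Rightarrow> (real^'p \<Rightarrow> 'a \<Rightarrow> real) \<Rightarrow> real^'p \<Rightarrow> real" where
  "mean_fun M L \<upsilon> = (\<integral>\<omega>. L \<upsilon> \<omega> \<partial>M)"

text \<open>``Linear in the parameter'' allows an additive random constant, as usual for a function
  whose gradient \<open>G\<close> does not depend on its argument.\<close>

definition stochastically_linear ::
    "'a measure \<Rightarrow> (real^'p) set \<Rightarrow> (real^'p \<Rightarrow> 'a \<Rightarrow> real) \<Rightarrow> ('a \<Rightarrow> real^'p) \<Rightarrow> bool" where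
  "stochastically_linear M \<Upsilon> L G \<longleftrightarrow> G \<in> borel_measurable M \<and>
     (\<forall>\<omega>\<in>space M. \<exists>c. \<forall>\<upsilon>\<in>\<Upsilon>. L \<upsilon> \<omega> - mean_fun M L \<upsilon> = c + inner (G \<omega>) \<upsilon>)"

definition z_quantile :: "real^'p^'p \<Rightarrow> real \<Rightarrow> real" where
  "z_quantile B x = sqrt (trace B + 2 * sqrt (x * trace (B ** B)) + 2 * x * op_norm B)"

text \<open>\<open>V2\<close> is the matrix written \<open>V\<^sup>2\<close>, so that \<open>V\<close> is its square root. Square integrability
  makes the variance matrix of \<open>G\<close> well defined.\<close>

definition deviation_condition :: "'a measure \<Rightarrow> ('a \<Rightarrow> real^'p) \<Rightarrow> real^'p^'p \<Rightarrow> bool" where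
  "deviation_condition M G V2 \<longleftrightarrow>
     integrable M (\<lambda>\<omega>. (norm (G \<omega>))\<^sup>2) \<and>
     pd_matrix V2 \<and> variance_matrix M G \<preceq>\<^sub>L V2 \<and>
     (\<forall>B x. pd_matrix B \<longrightarrow> 0 < x \<longrightarrow>
        measure M {\<omega> \<in> space M. norm (mat_sqrt B *v (mat_inv_sqrt V2 *v G \<omega>)) \<ge> z_quantile B x}
          \<le> 3 * exp (- x))"

definition delta3' :: "(real^'p \<Rightarrow> real) \<Rightarrow> real^'p \<Rightarrow> real^'p \<Rightarrow> real" where
  "delta3' f \<upsilon> u = inner (grad f (\<upsilon> + u)) u - inner (grad f \<upsilon>) u - inner u (hessian f \<upsilon> *v u)"

text \<open>The supremum is taken in the extended reals, so it is never an artefact of an unbounded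
  set. For \<open>D\<close> positive definite the only degenerate quotient is the one at \<open>u = 0\<close>; it is
  \<open>0 / 0 = 0\<close> and does not affect the value.\<close>

definition omega' ::
    "(real^'p \<Rightarrow> real) \<Rightarrow> real^'p \<Rightarrow> real^'p^'p \<Rightarrow> (real^'p) set \<Rightarrow> ereal" where
  "omega' f \<upsilon> D U = (SUP u\<in>U. ereal (\<bar>delta3' f \<upsilon> u\<bar> / (norm (D *v u))\<^sup>2))"

end

theory Submission
  imports Defs
begin

text \<open>Let \<open>S = F\<^sup>1\<^sup>/\<^sup>2\<close> and \<open>r = 4/3 r\<^sub>B\<close>. On \<open>\<Omega>\<close> the function \<open>L\<close> is, up to a constant, the convex function
  \<open>h \<upsilon> = f \<upsilon> + \<langle>\<nabla>\<zeta>, \<upsilon>\<rangle>\<close>. For \<open>\<parallel>S u\<parallel> = r\<close> the identity \<open>\<nabla>f(\<upsilon>\<^sup>*) = 0\<close>, the bound on \<open>\<omega>'\<close> and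
  \<open>\<parallel>S\<^sup>-\<^sup>1 \<nabla>\<zeta>\<parallel> \<le> r\<^sub>B\<close> give \<open>\<langle>\<nabla>h(\<upsilon>\<^sup>* + u), u\<rangle> > r\<^sup>2 - r\<^sup>2/4 - r\<^sub>B r = 0\<close>, so \<open>h\<close> increases outward
  across this ellipsoid and, by convexity, has no minimizer beyond it. The probability bound is
  the deviation condition for \<open>V F\<^sup>-\<^sup>1 V\<close>, which is orthogonally similar to \<open>B\<close>.\<close>

subsection \<open>Square roots of positive semidefinite matrices\<close>

lemma selfadjoint_form_le_imp_eigenvector:
  fixes f :: "'a::euclidean_space \<Rightarrow> 'a"
  assumes "linear f" and sym: "\<And>x y. x \<bullet> f y = f x \<bullet> y"
    and W: "subspace W" "f ` W \<subseteq> W" and v: "v \<in> W" "v \<bullet> f v = c * (norm v)\<^sup>2"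
    and le: "\<And>x. x \<in> W \<Longrightarrow> x \<bullet> f x \<le> c * (norm x)\<^sup>2"
  shows "f v = c *\<^sub>R v"
proof -
  interpret linear f by fact
  define y where "y = c *\<^sub>R v - f v"
  have yW: "y \<in> W"
    unfolding y_def using W v by (auto intro!: subspace_diff subspace_scale)
  define q where "q = c * (norm y)\<^sup>2 - y \<bullet> f y"
  have q0: "q \<ge> 0" using le[OF yW] by (simp add: q_def)
  \<comment> \<open>The form \<open>c \<parallel>x\<parallel>\<^sup>2 - x \<bullet> f x\<close> is nonnegative on \<open>W\<close> and vanishes at \<open>v\<close>, so its derivative there in direction \<open>y\<close> vanishes.\<close>
  have *: "0 \<le> 2 * t * (norm y)\<^sup>2 + t * t * q" for t
  proof -
    have "v + t *\<^sub>R y \<in> W" using W v yW by (auto intro!: subspace_add subspace_scale)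
    from le[OF this] have "0 \<le> c * (norm (v + t *\<^sub>R y))\<^sup>2 - (v + t *\<^sub>R y) \<bullet> f (v + t *\<^sub>R y)"
      by simp
    also have "(v + t *\<^sub>R y) \<bullet> f (v + t *\<^sub>R y)
        = v \<bullet> f v + 2 * t * (y \<bullet> f v) + t * t * (y \<bullet> f y)"
      using sym[of v y] inner_commute[of "f v" y]
      by (simp add: add scale inner_add_left inner_add_right algebra_simps)
    also have "(norm (v + t *\<^sub>R y))\<^sup>2 = (norm v)\<^sup>2 + 2 * t * (y \<bullet> v) + t * t * (norm y)\<^sup>2"
      using inner_commute[of v y]
      by (simp add: power2_norm_eq_inner inner_add_left inner_add_right algebra_simps)
    also have "c * \<dots> - (v \<bullet> f v + 2 * t * (y \<bullet> f v) + t * t * (y \<bullet> f y))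
        = (c * (norm v)\<^sup>2 - v \<bullet> f v) + 2 * t * (y \<bullet> (c *\<^sub>R v - f v)) + t * t * q"
      by (simp add: q_def inner_diff_right algebra_simps)
    also have "\<dots> = 2 * t * (norm y)\<^sup>2 + t * t * q"
      using v by (simp add: y_def[symmetric] power2_norm_eq_inner)
    finally show ?thesis .
  qed
  have "norm y = 0"
  proof (rule ccontr)
    assume "norm y \<noteq> 0"
    \<comment> \<open>At \<open>t = - s\<close> the negative linear term has to beat the quadratic
      one. Dividing by \<open>q + 1\<close> gives \<open>s * q < (norm y)\<^sup>2\<close> and also
      covers \<open>q = 0\<close>.\<close>
    define s where "s = (norm y)\<^sup>2 / (q + 1)"
    have "s > 0" using \<open>norm y \<noteq> 0\<close> q0 by (simp add: s_def)
    have "s * q < (norm y)\<^sup>2"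
      using \<open>norm y \<noteq> 0\<close> q0 by (simp add: s_def field_simps)
    then have "s * (s * q) < s * (norm y)\<^sup>2" using \<open>s > 0\<close> by simp
    moreover have "s * (norm y)\<^sup>2 \<ge> 0" using \<open>s > 0\<close> by simp
    ultimately show False using *[of "- s"] by (simp add: algebra_simps)
  qed
  then show ?thesis by (simp add: y_def)
qed

text \<open>The unit sphere of \<open>W\<close> is compact, so the quadratic form attains its
  maximum there. By homogeneity this maximum bounds the Rayleigh quotient on all of
  \<open>W\<close>, which makes the maximizer an eigenvector.\<close>

lemma selfadjoint_eigenvector_exists:
  fixes f :: "'a::euclidean_space \<Rightarrow> 'a"
  assumes "linear f" and sym: "\<And>x y. x \<bullet> f y = f x \<bullet> y"
    and W: "subspace W" "f ` W \<subseteq> W" "W \<noteq> {0}"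
  obtains v c where "v \<in> W" "norm v = 1" "f v = c *\<^sub>R v"
proof -
  interpret linear f by fact
  obtain w where w: "w \<in> W" "w \<noteq> 0"
    using W subspace_0 by blast
  have "compact (W \<inter> sphere 0 1)"
    by (intro closed_Int_compact closed_subspace W compact_sphere)
  moreover have "w /\<^sub>R norm w \<in> W \<inter> sphere 0 1"
    using w W(1) by (auto intro: subspace_scale)
  then have "W \<inter> sphere 0 1 \<noteq> {}" by blast
  moreover have "continuous_on (W \<inter> sphere 0 1) (\<lambda>x. x \<bullet> f x)"
    by (intro continuous_intros linear_continuous_on linear_conv_bounded_linear[THEN iffD1] assms)
  ultimately obtain v where v: "v \<in> W" "norm v = 1"
    and max: "\<And>x. x \<in> W \<Longrightarrow> norm x = 1 \<Longrightarrow> x \<bullet> f x \<le> v \<bullet> f v"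
    using continuous_attains_sup[of "W \<inter> sphere 0 1" "\<lambda>x. x \<bullet> f x"]
    by (metis IntE IntI dist_0_norm mem_sphere)
  have "x \<bullet> f x \<le> (v \<bullet> f v) * (norm x)\<^sup>2" if "x \<in> W" for x
  proof (cases "x = 0")
    case False
    have "(x /\<^sub>R norm x) \<bullet> f (x /\<^sub>R norm x) \<le> v \<bullet> f v"
      using that False W(1) by (intro max) (auto intro: subspace_scale)
    then show ?thesis using False by (simp add: scale field_simps power2_eq_square)
  qed (simp add: zero)
  then have "f v = (v \<bullet> f v) *\<^sub>R v"
    using v W by (intro selfadjoint_form_le_imp_eigenvector[of f W] assms) auto
  with v show thesis using that by blast
qed

text \<open>Induction on the dimension: a unit eigenvector \<open>v\<close> is split off, and its
  orthogonal complement in \<open>W\<close> is again invariant because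
  \<open>v \<bullet> f w = f v \<bullet> w = c * (v \<bullet> w)\<close>.\<close>

lemma selfadjoint_eigenbasis:
  fixes f :: "'a::euclidean_space \<Rightarrow> 'a"
  assumes "linear f" and sym: "\<And>x y. x \<bullet> f y = f x \<bullet> y"
    and "subspace W" "f ` W \<subseteq> W"
  shows "\<exists>B. finite B \<and> pairwise orthogonal B \<and> span B = W \<and>
           (\<forall>b\<in>B. norm b = 1 \<and> (\<exists>c. f b = c *\<^sub>R b))"
  using assms(3,4)
proof (induction "dim W" arbitrary: W rule: less_induct)
  case less
  show ?case
  proof (cases "W = {0}")
    case True
    then show ?thesis by (intro exI[of _ "{}"]) (auto simp: pairwise_def)
  next
    case False
    obtain v c where v: "v \<in> W" "norm v = 1" "f v = c *\<^sub>R v"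
      using selfadjoint_eigenvector_exists[OF assms(1) sym less.prems False] by blast
    define W' where "W' = W \<inter> {w. v \<bullet> w = 0}"
    have sub: "subspace W'"
      unfolding W'_def by (intro subspace_inter less.prems subspace_hyperplane)
    have "v \<bullet> v = 1" using v(2) by (metis norm_eq_1)
    have "f ` W' \<subseteq> W'"
      using less.prems(2) sym[of v] v(3) by (auto simp: W'_def)
    have "v \<notin> W'" using \<open>v \<bullet> v = 1\<close> by (simp add: W'_def)
    then have "W' \<subset> W" using v(1) by (metis Int_lower1 W'_def psubsetI)
    then have "dim W' < dim W"
      using sub less.prems(1) by (simp add: dim_psubset span_eq_iff[THEN iffD2])
    from less.hyps[OF this sub \<open>f ` W' \<subseteq> W'\<close>] obtain B
      where B: "finite B" "pairwise orthogonal B" "span B = W'"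
        "\<forall>b\<in>B. norm b = 1 \<and> (\<exists>c. f b = c *\<^sub>R b)" by blast
    have BW: "b \<in> W'" if "b \<in> B" for b using that B(3) span_base by blast
    have "span (insert v B) = W"
    proof
      show "span (insert v B) \<subseteq> W"
        using v BW less.prems(1) by (intro span_minimal) (auto simp: W'_def)
      show "W \<subseteq> span (insert v B)"
      proof
        fix w assume "w \<in> W"
        have "w - (w \<bullet> v) *\<^sub>R v \<in> W'"
          using \<open>w \<in> W\<close> v less.prems(1) \<open>v \<bullet> v = 1\<close>
          by (auto simp: W'_def inner_diff_right inner_commute intro!: subspace_diff subspace_scale)
        then show "w \<in> span (insert v B)" using B(3) by (auto simp: span_insert)
      qed
    qed
    moreover have "pairwise orthogonal (insert v B)"
      using B(2) BW by (auto simp: pairwise_insert W'_def orthogonal_def inner_commute)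
    ultimately show ?thesis using B v by (intro exI[of _ "insert v B"]) auto
  qed
qed

lemma transpose_eq_selfadjoint:
  fixes A :: "real^'n^'n"
  assumes "transpose A = A"
  shows "x \<bullet> (A *v y) = (A *v x) \<bullet> y"
  by (metis assms dot_lmul_matrix transpose_matrix_vector)

text \<open>The eigenvalue of a unit eigenvector is its Rayleigh quotient; writing it as
  \<open>b \<bullet> (A *v b)\<close> avoids a choice function for eigenvalues.\<close>

lemma symmetric_matrix_eigenbasis:
  fixes A :: "real^'n^'n"
  assumes "transpose A = A"
  obtains B where "finite B" "pairwise orthogonal B" "span B = UNIV" "\<And>b. b \<in> B \<Longrightarrow> norm b = 1"
    "\<And>b. b \<in> B \<Longrightarrow> A *v b = (b \<bullet> (A *v b)) *\<^sub>R b"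
proof -
  obtain B where "finite B" "pairwise orthogonal B" "span B = UNIV"
    and B: "\<forall>b\<in>B. norm b = 1 \<and> (\<exists>c. A *v b = c *\<^sub>R b)"
    using selfadjoint_eigenbasis[of "(*v) A" UNIV] transpose_eq_selfadjoint[OF assms]
    by auto
  moreover have "A *v b = (b \<bullet> (A *v b)) *\<^sub>R b" if "b \<in> B" for b
    using B that by (metis inner_scaleR_right mult.right_neutral norm_eq_1)
  ultimately show thesis using that by blast
qed

section \<open>Existence and uniqueness of the principal root\<close>

text \<open>In an orthonormal eigenbasis the root is the map \<open>g\<close> that scales each
  \<open>b\<close> by the square root of its eigenvalue.\<close>

lemma psd_sqrt_exists:
  assumes "psd_matrix A"
  obtains S where "psd_matrix S" "S ** S = A"
proof -
  obtain B where B: "finite B" "pairwise orthogonal B" "span B = UNIV" "\<And>b. b \<in> B \<Longrightarrow> norm b = 1"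
    "\<And>b. b \<in> B \<Longrightarrow> A *v b = (b \<bullet> (A *v b)) *\<^sub>R b"
    using assms symmetric_matrix_eigenbasis[of A] by (auto simp: psd_matrix_def)
  define s where "s b = sqrt (b \<bullet> (A *v b))" for b
  have s: "s b \<ge> 0" "s b * s b = b \<bullet> (A *v b)" for b
    using assms by (auto simp: s_def psd_matrix_def)
  define g where "g x = (\<Sum>b\<in>B. (s b * (x \<bullet> b)) *\<^sub>R b)" for x
  have "linear g"
    by (rule linearI)
      (auto simp: g_def inner_add_left scaleR_sum_right sum.distrib algebra_simps)
  then have g: "matrix g *v x = g x" for x
    using matrix_vector_mul(2)[OF \<open>linear g\<close>] by metis
  have orth: "b \<bullet> b' = (if b = b' then 1 else 0)" if "b \<in> B" "b' \<in> B" for b b'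
    using that B(2,4) by (auto simp: pairwise_def orthogonal_def norm_eq_1)
  have gb: "g b = s b *\<^sub>R b" if "b \<in> B" for b
    unfolding g_def using that B(1)
    by (simp add: orth if_distrib[of "\<lambda>x. _ * x"] if_distrib[of "\<lambda>x. x *\<^sub>R _"] cong: if_cong)
  have gsym: "x \<bullet> g y = g x \<bullet> y" for x y
    by (simp add: g_def inner_sum_left inner_sum_right inner_commute algebra_simps)
  have "matrix g ** matrix g = A"
  proof (rule matrix_eq[THEN iffD2], rule allI)
    fix x
    have "matrix g ** matrix g *v x = A *v x"
    proof (rule linear_eq_on_span[of "\<lambda>x. matrix g ** matrix g *v x" "\<lambda>x. A *v x" B])
      fix b assume "b \<in> B"
      then show "matrix g ** matrix g *v b = A *v b"
        using B(5)[of b] linear_scale[OF \<open>linear g\<close>]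
        by (simp add: matrix_vector_mul_assoc[symmetric] g gb s)
    qed (use B in auto)
    then show "matrix g ** matrix g *v x = A *v x" .
  qed
  moreover have "psd_matrix (matrix g)"
    unfolding psd_matrix_def
  proof
    show "transpose (matrix g) = matrix g"
      using gsym by (metis matrix_adjoint \<open>linear g\<close> adjoint_unique)
    show "\<forall>x. 0 \<le> x \<bullet> (matrix g *v x)"
      unfolding g by (auto simp: g_def inner_sum_right s mult.assoc intro!: sum_nonneg)
  qed
  ultimately show thesis using that by blast
qed

text \<open>Factor \<open>S\<^sup>2 - c\<close> as \<open>(S + sqrt c) (S - sqrt c)\<close>. For
  \<open>c > 0\<close> the first factor is positive definite, so the second annihilates
  \<open>b\<close>; for \<open>c = 0\<close> the squared norm of \<open>S *v b\<close> is
  \<open>b \<bullet> (S ** S *v b) = 0\<close>.\<close>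

lemma psd_sqrt_eigenvector:
  assumes S: "psd_matrix S" and b: "S ** S *v b = c *\<^sub>R b" and c: "c \<ge> 0"
  shows "S *v b = sqrt c *\<^sub>R b"
proof -
  define w where "w = S *v b - sqrt c *\<^sub>R b"
  have "S *v w + sqrt c *\<^sub>R w = 0"
    using b c by (simp add: w_def algebra_simps matrix_vector_mul_assoc)
  then have *: "w \<bullet> (S *v w) + sqrt c * (w \<bullet> w) = 0"
    by (metis inner_add_right inner_scaleR_right inner_zero_right)
  moreover have "w \<bullet> (S *v w) \<ge> 0" using S by (simp add: psd_matrix_def)
  moreover have "sqrt c * (w \<bullet> w) \<ge> 0" using c by simp
  ultimately have "sqrt c * (w \<bullet> w) = 0" by linarith
  then consider "c = 0" | "w = 0" by auto
  then show ?thesis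
  proof cases
    case 1
    have "(S *v b) \<bullet> (S *v b) = b \<bullet> (S ** S *v b)"
      using transpose_eq_selfadjoint[of S b "S *v b"] S
      by (simp add: psd_matrix_def matrix_vector_mul_assoc)
    then show ?thesis using 1 b by simp
  qed (simp add: w_def)
qed

text \<open>On an eigenbasis of the common square both roots must multiply by the nonnegative root
  of the eigenvalue, so they agree on a spanning set.\<close>

lemma psd_sqrt_unique:
  assumes "psd_matrix S" "psd_matrix T" "S ** S = T ** T"
  shows "S = T"
proof -
  let ?A = "S ** S"
  have form: "x \<bullet> (?A *v x) = (norm (S *v x))\<^sup>2" for x
    using transpose_eq_selfadjoint[of S x "S *v x"] assms(1)
    by (simp add: psd_matrix_def matrix_vector_mul_assoc power2_norm_eq_inner)
  have "transpose ?A = ?A"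
    using assms(1) by (simp add: matrix_transpose_mul psd_matrix_def)
  then obtain B where B: "span B = UNIV" "\<And>b. b \<in> B \<Longrightarrow> ?A *v b = (b \<bullet> (?A *v b)) *\<^sub>R b"
    using symmetric_matrix_eigenbasis[of ?A] by metis
  have *: "S *v b = T *v b" if "b \<in> B" for b
    using psd_sqrt_eigenvector[OF assms(1) B(2)[OF that]]
      psd_sqrt_eigenvector[OF assms(2) B(2)[OF that, unfolded assms(3)]]
    by (simp add: form flip: assms(3))
  have "S *v x = T *v x" for x
    by (rule linear_eq_on_span[of "(*v) S" "(*v) T" B]) (use * B in auto)
  then show ?thesis by (simp add: matrix_eq)
qed

lemma mat_sqrt:
  assumes "psd_matrix A"
  shows psd_mat_sqrt: "psd_matrix (mat_sqrt A)" and mat_sqrt_square: "mat_sqrt A ** mat_sqrt A = A"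
proof -
  have "\<exists>!S. psd_matrix S \<and> S ** S = A"
    using psd_sqrt_exists[OF assms] psd_sqrt_unique by metis
  from theI'[OF this] show "psd_matrix (mat_sqrt A)" "mat_sqrt A ** mat_sqrt A = A"
    by (auto simp: mat_sqrt_def)
qed

lemma pd_imp_psd: "pd_matrix A \<Longrightarrow> psd_matrix A"
  unfolding pd_matrix_def psd_matrix_def by (metis inner_zero_left less_imp_le order_refl)

lemma mat_sqrt_norm:
  assumes "psd_matrix A"
  shows "(norm (mat_sqrt A *v x))\<^sup>2 = x \<bullet> (A *v x)"
  using transpose_eq_selfadjoint[of "mat_sqrt A" x "mat_sqrt A *v x"] mat_sqrt[OF assms]
  by (simp add: psd_matrix_def matrix_vector_mul_assoc power2_norm_eq_inner)

text \<open>Positive definiteness makes the root injective, hence invertible, so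
  \<open>matrix_inv\<close> picks a genuine inverse. Its transpose is a left inverse of the same
  symmetric root and therefore equals it.\<close>

lemma mat_inv_sqrt:
  assumes "pd_matrix A"
  shows "mat_sqrt A ** mat_inv_sqrt A = mat 1" "mat_inv_sqrt A ** mat_sqrt A = mat 1"
    and "transpose (mat_inv_sqrt A) = mat_inv_sqrt A"
proof -
  let ?S = "mat_sqrt A"
  note psd = pd_imp_psd[OF assms]
  have "x = 0" if "?S *v x = 0" for x
    using that mat_sqrt_norm[OF psd, of x] assms unfolding pd_matrix_def
    by (metis less_irrefl norm_zero zero_power2)
  then have "invertible ?S"
    by (metis invertible_left_inverse matrix_left_invertible_ker)
  then have "?S ** mat_inv_sqrt A = mat 1 \<and> mat_inv_sqrt A ** ?S = mat 1"
    unfolding mat_inv_sqrt_def invertible_def matrix_inv_def by (rule someI_ex)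
  then show *: "?S ** mat_inv_sqrt A = mat 1" "mat_inv_sqrt A ** ?S = mat 1"
    by auto
  have "transpose (mat_inv_sqrt A) ** ?S = mat 1"
    using arg_cong[OF *(1), of transpose] psd_mat_sqrt[OF psd]
    by (simp add: matrix_transpose_mul psd_matrix_def)
  then show "transpose (mat_inv_sqrt A) = mat_inv_sqrt A"
    by (metis *(1) matrix_mul_assoc matrix_mul_lid matrix_mul_rid)
qed

subsection \<open>Operator norm and quantile of Gram matrices\<close>

lemma norm_le_op_norm: "norm (A *v x) \<le> op_norm A * norm x"
  unfolding op_norm_def by (rule onorm) (rule matrix_vector_mul_bounded_linear)

lemma op_norm_nonneg: "0 \<le> op_norm A"
  unfolding op_norm_def by (rule onorm_pos_le) (rule matrix_vector_mul_bounded_linear)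

lemma op_norm_le:
  assumes "0 \<le> c" "\<And>x. (norm (A *v x))\<^sup>2 \<le> c\<^sup>2 * (norm x)\<^sup>2"
  shows "op_norm A \<le> c"
  unfolding op_norm_def
proof (rule onorm_le)
  show "norm (A *v x) \<le> c * norm x" for x
    using assms(2)[of x] assms(1) by (auto simp flip: power_mult_distrib intro: power2_le_imp_le)
qed

lemma norm_square_gram:
  fixes A :: "real^'n^'n"
  shows "(norm (A *v x))\<^sup>2 = x \<bullet> (transpose A ** A *v x)"
proof -
  have "x \<bullet> (transpose A *v (A *v x)) = (A *v x) \<bullet> (A *v x)"
    by (metis dot_lmul_matrix transpose_matrix_vector transpose_transpose)
  then show ?thesis
    by (simp add: power2_norm_eq_inner matrix_vector_mul_assoc del: transpose_matrix_vector)
qed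

text \<open>Cauchy-Schwarz bounds the squared norm of \<open>transpose A *v x\<close> by
  \<open>norm x * op_norm A * norm (transpose A *v x)\<close>; cancelling one factor gives one
  inequality, and applying it to the transpose gives the other.\<close>

lemma op_norm_transpose: "op_norm (transpose A) = op_norm A"
proof -
  have le: "op_norm (transpose A) \<le> op_norm A" for A :: "real^'n^'n"
  proof (rule op_norm_le)
    fix x
    have "(norm (transpose A *v x))\<^sup>2 = x \<bullet> (A *v (transpose A *v x))"
      using norm_square_gram[of "transpose A" x]
      by (simp add: matrix_vector_mul_assoc del: transpose_matrix_vector)
    also have "\<dots> \<le> norm x * norm (A *v (transpose A *v x))"
      by (rule norm_cauchy_schwarz)
    also have "\<dots> \<le> norm x * (op_norm A * norm (transpose A *v x))"
      by (intro mult_left_mono norm_le_op_norm norm_ge_zero)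
    finally have "norm (transpose A *v x) * norm (transpose A *v x)
        \<le> (op_norm A * norm x) * norm (transpose A *v x)"
      by (simp add: power2_eq_square mult_ac)
    then have "norm (transpose A *v x) \<le> op_norm A * norm x"
      using op_norm_nonneg[of A]
      by (cases "norm (transpose A *v x) = 0") (auto simp: mult_le_cancel_right simp del: transpose_matrix_vector)
    then show "(norm (transpose A *v x))\<^sup>2 \<le> (op_norm A)\<^sup>2 * (norm x)\<^sup>2"
      by (metis norm_ge_zero power_mono power_mult_distrib)
  qed (rule op_norm_nonneg)
  from le[of A] le[of "transpose A"] show ?thesis by simp
qed

text \<open>This is the C*-identity: submultiplicativity in one direction, Cauchy-Schwarz for the
  Gram form in the other.\<close>

lemma op_norm_gram: "op_norm (transpose A ** A) = (op_norm A)\<^sup>2"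
proof (rule antisym)
  have "op_norm (transpose A ** A) \<le> op_norm (transpose A) * op_norm A"
    using onorm_compose[OF matrix_vector_mul_bounded_linear[of "transpose A"] matrix_vector_mul_bounded_linear[of A]]
    by (simp add: op_norm_def o_def matrix_vector_mul_assoc del: transpose_matrix_vector)
  also have "\<dots> = (op_norm A)\<^sup>2"
    by (simp add: op_norm_transpose power2_eq_square)
  finally show "op_norm (transpose A ** A) \<le> (op_norm A)\<^sup>2" .
  have "op_norm A \<le> sqrt (op_norm (transpose A ** A))"
  proof (rule op_norm_le)
    fix x
    have "(norm (A *v x))\<^sup>2 \<le> norm x * norm (transpose A ** A *v x)"
      unfolding norm_square_gram by (rule norm_cauchy_schwarz)
    also have "\<dots> \<le> norm x * (op_norm (transpose A ** A) * norm x)"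
      by (intro mult_left_mono norm_le_op_norm norm_ge_zero)
    finally show "(norm (A *v x))\<^sup>2 \<le> (sqrt (op_norm (transpose A ** A)))\<^sup>2 * (norm x)\<^sup>2"
      using op_norm_nonneg[of "transpose A ** A"] by (simp add: power2_eq_square mult_ac)
  qed (simp add: op_norm_nonneg)
  then show "(op_norm A)\<^sup>2 \<le> op_norm (transpose A ** A)"
    by (simp add: op_norm_nonneg real_le_rsqrt sqrt_ge_absD)
qed

text \<open>Cyclicity of the trace handles both traces, the C*-identity the operator norm. This
  allows exchanging the matrix that defines the radius for the one to which the deviation condition
  is applied.\<close>

lemma z_quantile_gram:
  fixes A :: "real^'n^'n"
  shows "z_quantile (A ** transpose A) x = z_quantile (transpose A ** A) x"
proof -
  have "op_norm (A ** transpose A) = op_norm (transpose A ** A)"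
    using op_norm_gram[of "transpose A"] by (simp add: op_norm_gram op_norm_transpose)
  moreover have "trace (A ** transpose A) = trace (transpose A ** A)"
    by (rule trace_mul_sym)
  moreover have "trace (A ** transpose A ** (A ** transpose A))
      = trace (transpose A ** A ** (transpose A ** A))"
    by (metis matrix_mul_assoc trace_mul_sym)
  ultimately show ?thesis by (simp add: z_quantile_def)
qed

text \<open>Testing the form on basis vectors shows that the diagonal is positive. Positivity of the
  quantile keeps the localizing ellipsoid nondegenerate.\<close>

lemma z_quantile_pos:
  assumes "pd_matrix B" "x > 0"
  shows "z_quantile B x > 0"
proof -
  have "B $ i $ i = axis i 1 \<bullet> (B *v axis i 1)" for i
    by (simp add: inner_axis' matrix_vector_mult_basis column_def)
  then have "trace B > 0"
    unfolding trace_def using assms(1)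
    by (intro sum_pos) (auto simp: pd_matrix_def axis_eq_0_iff)
  \<comment> \<open>In this form the trace is the sum of the squared entries.\<close>
  moreover have "trace (B ** B) = trace (transpose B ** B)"
    using assms(1) by (simp add: pd_matrix_def)
  then have "trace (B ** B) \<ge> 0"
    by (auto simp: trace_def matrix_matrix_mult_def transpose_def intro!: sum_nonneg)
  ultimately show ?thesis
    using assms(2) op_norm_nonneg[of B]
    by (simp add: z_quantile_def add_pos_nonneg)
qed

subsection \<open>Minimizers of convex functions\<close>

text \<open>The Riesz vector of the derivative is \<open>adjoint f' 1\<close>, and uniqueness of
  derivatives justifies the definite description in \<open>grad\<close>.\<close>

lemma GDERIV_grad:
  assumes "f differentiable (at x)"
  shows "GDERIV f x :> grad f x"
proof -
  obtain f' where f': "(f has_derivative f') (at x)"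
    using assms by (auto simp: differentiable_def)
  then have "linear f'" by (rule has_derivative_linear)
  have "f' = (\<lambda>h. h \<bullet> adjoint f' 1)"
    using adjoint_works[OF \<open>linear f'\<close>, of _ 1] by auto
  then have D: "GDERIV f x :> adjoint f' 1"
    using f' by (simp add: gderiv_def)
  moreover have "D' = adjoint f' 1" if "GDERIV f x :> D'" for D'
  proof -
    have "(\<lambda>h. h \<bullet> D') = (\<lambda>h. h \<bullet> adjoint f' 1)"
      using that D unfolding gderiv_def by (rule has_derivative_unique)
    then show ?thesis by (metis vector_eq_ldot)
  qed
  ultimately show ?thesis
    unfolding grad_def by (rule theI)
qed

text \<open>Along the segment from \<open>w\<close> to \<open>y\<close>, convexity bounds the
  difference quotients for \<open>0 < s < 1\<close> by the chord slope \<open>h y - h w\<close>; the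
  gradient term is their limit from the right.\<close>

lemma convex_on_gradient_ineq:
  assumes "convex_on T h" "w \<in> T" "y \<in> T" and D: "GDERIV h w :> D"
  shows "D \<bullet> (y - w) \<le> h y - h w"
proof -
  let ?\<phi> = "\<lambda>s. h (w + s *\<^sub>R (y - w))"
  have "((\<lambda>s. w + s *\<^sub>R (y - w)) has_derivative (\<lambda>s. s *\<^sub>R (y - w))) (at 0)"
    by (auto intro!: derivative_eq_intros)
  moreover have "(h has_derivative (\<lambda>k. k \<bullet> D)) (at (w + 0 *\<^sub>R (y - w)))"
    using D by (simp add: gderiv_def)
  ultimately have "(?\<phi> has_derivative (\<lambda>s. (s *\<^sub>R (y - w)) \<bullet> D)) (at 0)"
    by (rule has_derivative_compose)
  then have "(?\<phi> has_real_derivative D \<bullet> (y - w)) (at 0)"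
    by (simp add: has_field_derivative_def inner_commute mult.commute[of _ "inner _ _"])
  then have "((\<lambda>s. (?\<phi> s - h w) / s) \<longlongrightarrow> D \<bullet> (y - w)) (at 0)"
    by (simp add: DERIV_def)
  then have "((\<lambda>s. (?\<phi> s - h w) / s) \<longlongrightarrow> D \<bullet> (y - w)) (at_right 0)"
    by (rule tendsto_within_subset) simp
  moreover have "eventually (\<lambda>s. (?\<phi> s - h w) / s \<le> h y - h w) (at_right 0)"
    using eventually_at_right_less[of 0]
      eventually_at_right_real[of 0 1, OF zero_less_one]
  proof eventually_elim
    case (elim s)
    have "?\<phi> s = h ((1 - s) *\<^sub>R w + s *\<^sub>R y)" by (simp add: algebra_simps)
    also have "\<dots> \<le> (1 - s) * h w + s * h y"
      using elim assms by (intro convex_onD) auto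
    finally show ?case using elim by (simp add: field_simps)
  qed
  ultimately show ?thesis
    by (intro tendsto_upperbound[where F = "at_right 0"]) auto
qed

text \<open>If \<open>w\<close> lay outside, the segment from \<open>v\<close> to \<open>w\<close>
  would cross the boundary at some \<open>v + u\<close>. There \<open>h\<close> increases in
  direction \<open>u\<close>, which points on to \<open>w\<close>, so the gradient inequality makes
  \<open>h w\<close> exceed \<open>h (v + u)\<close>.\<close>

lemma convex_minimizer_in_ellipsoid:
  assumes "convex_on T h" "v \<in> T" "w \<in> T" and min: "\<And>y. y \<in> T \<Longrightarrow> h w \<le> h y"
    and "linear S" "r > 0"
    and D: "\<And>u. norm (S u) = r \<Longrightarrow> GDERIV h (v + u) :> D u"
    and pos: "\<And>u. norm (S u) = r \<Longrightarrow> 0 < D u \<bullet> u"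
  shows "norm (S (w - v)) \<le> r"
proof (rule ccontr)
  assume "\<not> ?thesis"
  then have *: "r < norm (S (w - v))" by simp
  define t where "t = r / norm (S (w - v))"
  have t: "0 < t" "t < 1" using * \<open>r > 0\<close> less_trans[OF \<open>r > 0\<close> *]
    by (simp_all add: t_def)
  define u where "u = t *\<^sub>R (w - v)"
  have u: "norm (S u) = r"
    using * \<open>r > 0\<close> by (auto simp: u_def t_def linear_scale[OF \<open>linear S\<close>])
  have "v + u = (1 - t) *\<^sub>R v + t *\<^sub>R w" by (simp add: u_def algebra_simps)
  also have "\<dots> \<in> T"
    using assms(1-3) t by (auto simp: convex_on_def intro!: convexD)
  finally have "v + u \<in> T" .
  from convex_on_gradient_ineq[OF assms(1) this assms(3) D[OF u]] min[OF this]
  have "D u \<bullet> (w - (v + u)) \<le> 0" by simp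
  moreover have "w - (v + u) = ((1 - t) / t) *\<^sub>R u"
  proof -
    have "((1 - t) / t) *\<^sub>R u = (1 - t) *\<^sub>R (w - v)" using t by (simp add: u_def)
    then show ?thesis by (simp add: u_def algebra_simps)
  qed
  ultimately have "(1 - t) / t * (D u \<bullet> u) \<le> 0" by simp
  then show False using t pos[OF u] by (simp add: mult_le_0_iff divide_le_0_iff)
qed

subsection \<open>The deviation bound and localization\<close>

text \<open>Let \<open>A\<close> be the inverse root of \<open>F\<close> times the root of
  \<open>V2\<close>. The radius belongs to \<open>A ** transpose A\<close>, while the deviation
  condition is used for \<open>B = transpose A ** A\<close>: its root applied to the standardized
  \<open>G \<omega>\<close> has the norm of \<open>mat_inv_sqrt F *v G \<omega>\<close>, and both
  matrices have the same quantile.\<close>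

lemma deviation_condition_whitened:
  assumes "prob_space M" "G \<in> borel_measurable M" "deviation_condition M G V2" "pd_matrix F" "x > 0"
  defines "r \<equiv> z_quantile (mat_inv_sqrt F ** V2 ** mat_inv_sqrt F) x"
  shows "r > 0"
    and "measure M {\<omega> \<in> space M. norm (mat_inv_sqrt F *v G \<omega>) \<le> r} \<ge> 1 - 3 * exp (- x)"
proof -
  interpret prob_space M by fact
  have V2: "pd_matrix V2"
    and dev: "\<And>B. pd_matrix B \<Longrightarrow>
      prob {\<omega> \<in> space M. norm (mat_sqrt B *v (mat_inv_sqrt V2 *v G \<omega>)) \<ge> z_quantile B x} \<le> 3 * exp (- x)"
    using assms by (auto simp: deviation_condition_def)
  let ?V = "mat_sqrt V2"
  define A where "A = mat_inv_sqrt F ** ?V"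
  define B where "B = transpose A ** A"
  have "transpose ?V = ?V" "?V ** ?V = V2"
    using mat_sqrt[OF pd_imp_psd[OF V2]] by (auto simp: psd_matrix_def)
  then have "A ** transpose A = mat_inv_sqrt F ** V2 ** mat_inv_sqrt F"
    using mat_inv_sqrt(3)[OF assms(4)]
    by (simp add: A_def matrix_transpose_mul) (metis matrix_mul_assoc)
  then have r: "r = z_quantile B x"
    unfolding r_def B_def by (metis z_quantile_gram)
  have form: "y \<bullet> (B *v y) = (norm (A *v y))\<^sup>2" for y
    by (simp add: B_def norm_square_gram)
  have A0: "y = 0" if "A *v y = 0" for y
  proof -
    have "mat_inv_sqrt V2 *v (mat_sqrt F *v (A *v y)) = y"
      unfolding A_def
      by (metis mat_inv_sqrt(1)[OF assms(4)] mat_inv_sqrt(2)[OF V2] matrix_vector_mul_assoc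
          matrix_vector_mul_lid)
    then show ?thesis using that by simp
  qed
  then have B: "pd_matrix B"
    unfolding pd_matrix_def form by (auto simp: B_def matrix_transpose_mul)
  show "r > 0" unfolding r by (rule z_quantile_pos[OF B assms(5)])
  have *: "norm (mat_sqrt B *v (mat_inv_sqrt V2 *v y)) = norm (mat_inv_sqrt F *v y)" for y
  proof -
    have "A *v (mat_inv_sqrt V2 *v y) = mat_inv_sqrt F *v y"
      unfolding A_def
      by (metis mat_inv_sqrt(1)[OF V2] matrix_vector_mul_assoc matrix_vector_mul_lid)
    then have "(norm (mat_sqrt B *v (mat_inv_sqrt V2 *v y)))\<^sup>2 = (norm (mat_inv_sqrt F *v y))\<^sup>2"
      by (simp add: mat_sqrt_norm[OF pd_imp_psd[OF B]] form)
    then show ?thesis by simp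
  qed
  have meas [measurable]: "(\<lambda>\<omega>. norm (mat_inv_sqrt F *v G \<omega>)) \<in> borel_measurable M"
    using measurable_compose[OF assms(2), of "\<lambda>y. norm (mat_inv_sqrt F *v y)" borel]
    by (simp add: borel_measurable_continuous_onI continuous_intros)
  let ?E = "{\<omega> \<in> space M. norm (mat_inv_sqrt F *v G \<omega>) \<le> r}"
  have "1 - prob ?E = prob (space M - ?E)"
    by (subst prob_compl) auto
  also have "\<dots> \<le> prob {\<omega> \<in> space M. norm (mat_inv_sqrt F *v G \<omega>) \<ge> r}"
    by (intro finite_measure_mono) auto
  also have "\<dots> \<le> 3 * exp (- x)" using dev[OF B] by (simp add: * r)
  finally show "prob ?E \<ge> 1 - 3 * exp (- x)" by simp
qed

lemma GDERIV_zero_at_min: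
  assumes "is_arg_min f (\<lambda>y. y \<in> T) v" "open T" "GDERIV f v :> D"
  shows "D = 0"
proof -
  have "(\<lambda>h. h \<bullet> D) = (\<lambda>h. 0)"
    using assms
    by (intro differential_zero_maxmin[of v T f]) (auto simp: is_arg_min_def gderiv_def not_less)
  then show ?thesis by (metis inner_eq_zero_iff)
qed

text \<open>Each quotient lies below the supremum, and the strict bound on the supremum passes to
  it. Since \<open>D *v u\<close> is nonzero, the denominator can be cleared, leaving a purely real
  inequality.\<close>

lemma omega'_bound:
  assumes "ereal c * omega' f v D U < ereal q" "0 < c" "u \<in> U" "D *v u \<noteq> 0"
  shows "c * \<bar>delta3' f v u\<bar> < q * (norm (D *v u))\<^sup>2"
proof -
  have "ereal (\<bar>delta3' f v u\<bar> / (norm (D *v u))\<^sup>2) \<le> omega' f v D U"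
    unfolding omega'_def by (rule SUP_upper) fact
  then have "ereal c * ereal (\<bar>delta3' f v u\<bar> / (norm (D *v u))\<^sup>2) \<le> ereal c * omega' f v D U"
    using assms(2) by (intro ereal_mult_left_mono) auto
  also note assms(1)
  finally show ?thesis using assms(4) by (simp add: field_simps)
qed

theorem proposition2p1:
  fixes M :: "'a measure"
    and \<Upsilon> :: "(real^'p) set"
    and L :: "real^'p \<Rightarrow> 'a \<Rightarrow> real"
    and grad_zeta :: "'a \<Rightarrow> real^'p"
    and \<upsilon>s :: "real^'p"
    and V2 D :: "real^'p^'p"
    and x \<kappa> :: real
  defines "f \<equiv> mean_fun M L"
  defines "F \<equiv> hessian f \<upsilon>s"
  defines "B \<equiv> mat_inv_sqrt F ** V2 ** mat_inv_sqrt F"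
  defines "r\<^sub>B \<equiv> z_quantile B x"
  defines "U \<equiv> {u. norm (mat_sqrt F *v u) \<le> 4/3 * r\<^sub>B}"
  defines "\<Omega> \<equiv> {\<omega> \<in> space M. norm (mat_inv_sqrt F *v grad_zeta \<omega>) \<le> r\<^sub>B}"
  assumes "prob_space M"
    and "\<And>\<upsilon>. \<upsilon> \<in> \<Upsilon> \<Longrightarrow> integrable M (L \<upsilon>)"
    and "is_arg_min f (\<lambda>\<upsilon>. \<upsilon> \<in> \<Upsilon>) \<upsilon>s"
    and "\<And>u. u \<in> U \<Longrightarrow> \<upsilon>s + u \<in> \<Upsilon> \<and> f differentiable (at (\<upsilon>s + u))"
    and "grad f differentiable (at \<upsilon>s)"
    and "pd_matrix F"
    and "stochastically_linear M \<Upsilon> L grad_zeta"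
    and "deviation_condition M grad_zeta V2"
    and "open \<Upsilon>" and "convex \<Upsilon>" and "convex_on \<Upsilon> f"
    and "x > 0" and "\<kappa> > 0"
    and "pd_matrix D" and "D ** D \<preceq>\<^sub>L \<kappa>\<^sup>2 *\<^sub>R F"
    and "ereal (\<kappa>\<^sup>2) * omega' f \<upsilon>s D U < ereal (1/4)"
  shows "measure M \<Omega> \<ge> 1 - 3 * exp (- x) \<and>
    (\<forall>\<omega>\<in>\<Omega>. \<forall>\<upsilon>t. is_arg_min (\<lambda>\<upsilon>. L \<upsilon> \<omega>) (\<lambda>\<upsilon>. \<upsilon> \<in> \<Upsilon>) \<upsilon>t \<longrightarrow>
       norm (mat_sqrt F *v (\<upsilon>t - \<upsilon>s)) \<le> 4/3 * r\<^sub>B \<and>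
       norm (D *v (\<upsilon>t - \<upsilon>s)) \<le> 4 * \<kappa> / 3 * r\<^sub>B)"
proof -
  have diff: "f differentiable (at (\<upsilon>s + u))" if "u \<in> U" for u
    using assms that by blast
  note F = \<open>pd_matrix F\<close> and D = \<open>pd_matrix D\<close> and min = \<open>is_arg_min f (\<lambda>\<upsilon>. \<upsilon> \<in> \<Upsilon>) \<upsilon>s\<close>
  note Fpsd = pd_imp_psd[OF F]
  let ?S = "mat_sqrt F" and ?r = "4/3 * r\<^sub>B"
  have lin: "stochastically_linear M \<Upsilon> L grad_zeta" by fact
  have prob: "r\<^sub>B > 0" "measure M \<Omega> \<ge> 1 - 3 * exp (- x)"
    unfolding r\<^sub>B_def B_def \<Omega>_def
    using deviation_condition_whitened[OF \<open>prob_space M\<close> _ \<open>deviation_condition M grad_zeta V2\<close> F \<open>x > 0\<close>] lin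
    by (auto simp: stochastically_linear_def)
  \<comment> \<open>The Loewner bound as a comparison of norms serves twice: to remove
    \<open>D\<close> from the remainder bound and to derive the second estimate from the
    first.\<close>
  have DF: "(norm (D *v u))\<^sup>2 \<le> \<kappa>\<^sup>2 * (norm (?S *v u))\<^sup>2" for u
  proof -
    have "0 \<le> u \<bullet> ((\<kappa>\<^sup>2 *\<^sub>R F - D ** D) *v u)"
      using \<open>D ** D \<preceq>\<^sub>L \<kappa>\<^sup>2 *\<^sub>R F\<close> by (simp add: loewner_le_def psd_matrix_def)
    also have "\<dots> = \<kappa>\<^sup>2 * (u \<bullet> (F *v u)) - u \<bullet> (D ** D *v u)"
      by (simp add: matrix_vector_mult_diff_rdistrib inner_diff_right scaleR_matrix_vector_assoc[symmetric])
    also have "u \<bullet> (D ** D *v u) = (norm (D *v u))\<^sup>2"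
      using norm_square_gram[of D u] D by (simp add: pd_matrix_def)
    finally show ?thesis by (simp add: mat_sqrt_norm[OF Fpsd])
  qed
  \<comment> \<open>Differentiability at \<open>\<upsilon>s\<close> is the case
    \<open>u = 0\<close>, which lies in \<open>U\<close> because the radius is positive.\<close>
  have "grad f \<upsilon>s = 0"
    using GDERIV_zero_at_min[OF min \<open>open \<Upsilon>\<close> GDERIV_grad] diff[of 0] prob(1)
    by (simp add: U_def)
  \<comment> \<open>The quadratic part contributes \<open>?r\<^sup>2\<close> and the remainder costs
    less than a quarter of it. The radius factor \<open>4/3\<close> is chosen so that what is left
    equals the noise bound \<open>r\<^sub>B * ?r\<close>.\<close>
  have gradf: "3/4 * ?r\<^sup>2 < grad f (\<upsilon>s + u) \<bullet> u" if u: "norm (?S *v u) = ?r" for u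
  proof -
    have "u \<noteq> 0" using u prob(1) by auto
    then have "D *v u \<noteq> 0" using D by (auto simp: pd_matrix_def)
    have "u \<in> U" using u by (simp add: U_def)
    have "\<kappa>\<^sup>2 * \<bar>delta3' f \<upsilon>s u\<bar> < 1/4 * (norm (D *v u))\<^sup>2"
      using \<open>\<kappa> > 0\<close>
      by (intro omega'_bound[OF \<open>ereal (\<kappa>\<^sup>2) * omega' f \<upsilon>s D U < ereal (1/4)\<close> _ \<open>u \<in> U\<close> \<open>D *v u \<noteq> 0\<close>]) simp
    also have "\<dots> \<le> \<kappa>\<^sup>2 * (1/4 * ?r\<^sup>2)" using DF[of u] u by simp
    finally have "\<bar>delta3' f \<upsilon>s u\<bar> < 1/4 * ?r\<^sup>2"
      using \<open>\<kappa> > 0\<close> by (simp add: mult_less_cancel_left)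
    moreover have "delta3' f \<upsilon>s u = grad f (\<upsilon>s + u) \<bullet> u - ?r\<^sup>2"
    proof -
      have "u \<bullet> (F *v u) = ?r\<^sup>2" by (simp only: u mat_sqrt_norm[OF Fpsd, symmetric])
      then show ?thesis using \<open>grad f \<upsilon>s = 0\<close> by (simp add: delta3'_def F_def)
    qed
    ultimately show ?thesis by linarith
  qed
  have "norm (?S *v (\<upsilon>t - \<upsilon>s)) \<le> ?r"
    if \<omega>: "\<omega> \<in> \<Omega>" and \<upsilon>t: "is_arg_min (\<lambda>\<upsilon>. L \<upsilon> \<omega>) (\<lambda>\<upsilon>. \<upsilon> \<in> \<Upsilon>) \<upsilon>t" for \<omega> \<upsilon>t
  proof -
    let ?g = "grad_zeta \<omega>" and ?h = "\<lambda>\<upsilon>. f \<upsilon> + grad_zeta \<omega> \<bullet> \<upsilon>"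
    \<comment> \<open>The constant depends on \<open>\<omega>\<close> but not on the parameter, so
      minimizers over \<open>\<Upsilon>\<close> are unaffected.\<close>
    obtain c where c: "\<And>\<upsilon>. \<upsilon> \<in> \<Upsilon> \<Longrightarrow> L \<upsilon> \<omega> = c + ?h \<upsilon>"
      using lin \<omega> unfolding stochastically_linear_def \<Omega>_def f_def
      by (force simp: algebra_simps)
    show ?thesis
    proof (rule convex_minimizer_in_ellipsoid[of \<Upsilon> ?h \<upsilon>s \<upsilon>t _ _ "\<lambda>u. grad f (\<upsilon>s + u) + ?g"])
      have "convex_on \<Upsilon> (\<lambda>\<upsilon>. ?g \<bullet> \<upsilon>)"
        using \<open>convex \<Upsilon>\<close> by (auto simp: convex_on_def inner_add_right)
      then show "convex_on \<Upsilon> ?h"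
        using \<open>convex_on \<Upsilon> f\<close> by (rule convex_on_add[rotated])
      show "\<upsilon>s \<in> \<Upsilon>" "\<upsilon>t \<in> \<Upsilon>" using min \<upsilon>t by (auto simp: is_arg_min_def)
      show "?h \<upsilon>t \<le> ?h y" if "y \<in> \<Upsilon>" for y
        using \<upsilon>t c[OF that] c[of \<upsilon>t] that by (auto simp: is_arg_min_def not_less)
      show "GDERIV ?h (\<upsilon>s + u) :> grad f (\<upsilon>s + u) + ?g" if "norm (?S *v u) = ?r" for u
      proof (rule GDERIV_add[OF GDERIV_grad])
        show "f differentiable (at (\<upsilon>s + u))" using that by (intro diff) (simp add: U_def)
        show "GDERIV (\<lambda>\<upsilon>. ?g \<bullet> \<upsilon>) (\<upsilon>s + u) :> ?g"
          unfolding gderiv_def by (auto intro!: derivative_eq_intros simp: inner_commute)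
      qed
      show "0 < (grad f (\<upsilon>s + u) + ?g) \<bullet> u" if u: "norm (?S *v u) = ?r" for u
      proof -
        \<comment> \<open>Inserting the root and its inverse splits the noise term into the factor
          controlled on \<open>\<Omega>\<close> and the factor of norm \<open>?r\<close>.\<close>
        have "?g \<bullet> u = ?g \<bullet> (mat_inv_sqrt F *v (?S *v u))"
          by (simp add: matrix_vector_mul_assoc mat_inv_sqrt(2)[OF F])
        also have "\<dots> = (mat_inv_sqrt F *v ?g) \<bullet> (?S *v u)"
          by (rule transpose_eq_selfadjoint[OF mat_inv_sqrt(3)[OF F]])
        finally have "\<bar>?g \<bullet> u\<bar> \<le> norm (mat_inv_sqrt F *v ?g) * ?r"
          using Cauchy_Schwarz_ineq2[of "mat_inv_sqrt F *v ?g" "?S *v u"] u by simp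
        also have "\<dots> \<le> r\<^sub>B * ?r"
          using \<omega> prob(1) by (intro mult_right_mono) (auto simp: \<Omega>_def)
        also have "\<dots> = 3/4 * ?r\<^sup>2" by (simp add: power2_eq_square)
        finally show ?thesis using gradf[OF u] by (simp add: inner_add_left)
      qed
    qed (use prob in auto)
  qed
  moreover have "norm (D *v u) \<le> 4 * \<kappa> / 3 * r\<^sub>B" if "norm (?S *v u) \<le> ?r" for u
  proof -
    have "(norm (D *v u))\<^sup>2 \<le> (\<kappa> * norm (?S *v u))\<^sup>2" using DF by (simp add: power_mult_distrib)
    then have "norm (D *v u) \<le> \<kappa> * norm (?S *v u)"
      using \<open>\<kappa> > 0\<close> by (intro power2_le_imp_le[of "norm (D *v u)"]) auto
    also have "\<dots> \<le> \<kappa> * ?r" using that \<open>\<kappa> > 0\<close> by simp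
    finally show ?thesis by simp
  qed
  ultimately show ?thesis using prob(2) by blast
qed

end
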